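(* Let $(E,d)$ be a bounded complete SR metric space. Let $T:E\to E$ be a nonexpansive map which satisfies the PAR-condition at a point $x\in E$. Then the sequence $(T^n(x))_{n\in\mathbb N}$ polarly converges to a fixed point of $T$.
   Context: For a subset $X$ of a metric space $(E,d)$, its Chebyshev radius is $\mathrm{rad}(X)=\inf_{x\in E}\sup_{y\in X}d(x,y)$. $B_\rho(x)$ denotes the ball of radius $\rho$ centered at $x$. A metric space $(E,d)$ is an SR ("Staples rotund") metric space if there exists a function $\delta:(0,\infty)^2\to(0,\infty)$ such that for all $r,\overline d>0$, setting $\delta=\delta(r,\overline d)$, for all $x,y\in E$ with $d(x,y)\ge\overline d$ one has $$\mathrm{rad}\big(B_{r+\delta}(x)\cap B_{r+\delta}(y)\big)\le r-\delta .$$ A map $T:E\to E$ is nonexpansive if $d(T(u),T(v))\le d(u,v)$ for all $u,v\in E$. $T^n$ is the $n$-th iterate of $T$. A sequence $(x_n)_{n\in\mathbb N}$ in $E$ polarly converges to $x\in E$ ($x$ is a polar limit of $(x_n)$) if for every $y\in E$ with $y\neq x$ there exists $M(y)\in\mathbb N$ such that $d(x_n,x)<d(x_n,y)$ for all $n\ge M(y)$. PAR-condition (polar asymptotical regularity condition): a map $T:E\to E$ satisfies the PAR-condition at $x\in E$ if, for any $y\in E$ which is the polar limit of a subsequence $(T^{k_n}(x))_{n\in\mathbb N}$ of $(T^n(x))_{n\in\mathbb N}$, and for every $\varepsilon>0$, there exists $\bar n\in\mathbb N$ such that $d(T^{k_n-1}(x),y)<d(T^{k_n}(x),y)+\varepsilon$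 for all $n\ge\bar n$. *)

theory Defs
  imports "HOL-Analysis.Analysis"
begin

text \<open>A metric space \<open>(E,d)\<close> is a type of class \<^class>\<open>metric_space\<close> with \<open>d\<close> = \<^const>\<open>dist\<close>.
  The Chebyshev radius is an extended real, so that it is meaningful for unbounded sets too.
  The empty set has radius \<open>-\<infinity>\<close> here rather than \<open>0\<close>. This does not affect \<open>SR_space\<close>
  below: a value of \<open>\<delta>\<close> may always be replaced by a smaller positive one, so one may assume
  \<open>\<delta> \<le> r\<close>.\<close>

definition chebyshev_radius :: "'a::metric_space set \<Rightarrow> ereal" where
  "chebyshev_radius X = (INF x. SUP y\<in>X. ereal (dist x y))"

text \<open>Open balls are used. Closed balls give the same class of spaces, since the closed ball of
  radius \<open>r + \<delta> / 2\<close> lies in the open ball of radius \<open>r + \<delta>\<close>.\<close>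

definition SR_space :: "'a::metric_space itself \<Rightarrow> bool" where
  "SR_space _ \<longleftrightarrow>
    (\<exists>\<delta> :: real \<Rightarrow> real \<Rightarrow> real.
      (\<forall>r>0. \<forall>D>0. \<delta> r D > 0 \<and>
        (\<forall>x y :: 'a. dist x y \<ge> D \<longrightarrow>
          chebyshev_radius (ball x (r + \<delta> r D) \<inter> ball y (r + \<delta> r D)) \<le> ereal (r - \<delta> r D))))"

definition nonexpansive :: "('a::metric_space \<Rightarrow> 'a) \<Rightarrow> bool" where
  "nonexpansive T \<longleftrightarrow> (\<forall>u v. dist (T u) (T v) \<le> dist u v)"

definition polarly_converges :: "(nat \<Rightarrow> 'a::metric_space) \<Rightarrow> 'a \<Rightarrow> bool" where
  "polarly_converges u x \<longleftrightarrow> (\<forall>y. y \<noteq> x \<longrightarrow> (\<exists>M. \<forall>n\<ge>M. dist (u n) x < dist (u n) y))"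

text \<open>The truncated subtraction in \<open>k n - 1\<close> is harmless: \<open>k n = 0\<close> is possible only for
  \<open>n = 0\<close>, which is excluded by taking \<open>N \<ge> 1\<close>.\<close>

definition PAR_condition :: "('a::metric_space \<Rightarrow> 'a) \<Rightarrow> 'a \<Rightarrow> bool" where
  "PAR_condition T x \<longleftrightarrow>
    (\<forall>(k :: nat \<Rightarrow> nat) y.
      strict_mono k \<longrightarrow> polarly_converges (\<lambda>n. (T ^^ k n) x) y \<longrightarrow>
      (\<forall>\<epsilon>>0. \<exists>N. \<forall>n\<ge>N. dist ((T ^^ (k n - 1)) x) y < dist ((T ^^ k n) x) y + \<epsilon>))"

end

theory Submission
  imports Defs "HOL-Library.Diagonal_Subsequence"
begin

text \<open>The asymptotic centres of a bounded sequence minimise \<open>y \<mapsto> limsup d(u\<^sub>n, y)\<close>. Rotundity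
  forces approximate minimisers to be close to each other, so by completeness there is exactly one
  asymptotic centre. A diagonal argument yields a subsequence all of whose subsequences have the
  same asymptotic radius, and such a subsequence polarly converges to its centre. If a subsequence
  of the orbit polarly converges to \<open>y\<close>, the PAR-condition makes \<open>T y\<close> another asymptotic centre
  of it, so \<open>T y = y\<close>. Since the distances from the orbit to fixed points decrease, all these polar
  limits are asymptotic centres of one and the same sequence and thus coincide.\<close>

section \<open>Asymptotic radius and asymptotic centres of sequences\<close>

text \<open>For bounded sequences this is the infimum over \<open>y\<close> of limsup
  \<open>dist (u n) y\<close>; eventual strict bounds keep everything in the reals.\<close>

definition asymptotic_radius :: "(nat \<Rightarrow> 'a::metric_space) \<Rightarrow> real" where
  "asymptotic_radius u = Inf {e. \<exists>y. \<forall>\<^sub>F n in sequentially. dist (u n) y < e}"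

definition asymptotic_center :: "(nat \<Rightarrow> 'a::metric_space) \<Rightarrow> 'a \<Rightarrow> bool" where
  "asymptotic_center u c \<longleftrightarrow>
    (\<forall>e > asymptotic_radius u. \<forall>\<^sub>F n in sequentially. dist (u n) c < e)"

lemma eventually_dist_less_pos:
  assumes "\<forall>\<^sub>F n in sequentially. dist (u n) y < e"
  shows "0 < e"
proof -
  obtain n where "dist (u n) y < e"
    using eventually_happens[OF assms] by auto
  then show ?thesis
    using zero_le_dist[of "u n" y] by linarith
qed

lemma asymptotic_radius_le:
  assumes "\<forall>\<^sub>F n in sequentially. dist (u n) y < e"
  shows "asymptotic_radius u \<le> e"
  unfolding asymptotic_radius_def
proof (rule cInf_lower)
  show "bdd_below {e. \<exists>y. \<forall>\<^sub>F n in sequentially. dist (u n) y < e}"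
    by (rule bdd_belowI[of _ 0]) (auto dest: eventually_dist_less_pos)
qed (use assms in auto)

text \<open>The real \<open>Inf\<close> can be worked with only on a nonempty set; boundedness
  supplies an element.\<close>

lemma eventual_bounds_nonempty:
  assumes "bounded (range u)"
  shows "{e. \<exists>y. \<forall>\<^sub>F n in sequentially. dist (u n) y < e} \<noteq> {}"
proof -
  obtain y e where "\<And>n. dist y (u n) \<le> e"
    using assms unfolding bounded_def by auto
  then have "\<forall>n. dist (u n) y < e + 1"
    by (metis dist_commute less_add_one order_le_less_trans)
  then show ?thesis
    by (auto intro!: exI[of _ "e + 1"] exI[of _ y])
qed

lemma asymptotic_radius_less:
  assumes "bounded (range u)" and "asymptotic_radius u < e"
  shows "\<exists>y. \<forall>\<^sub>F n in sequentially. dist (u n) y < e"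
proof -
  obtain e' y where e': "e' < e" and y: "\<forall>\<^sub>F n in sequentially. dist (u n) y < e'"
    using cInf_lessD[OF eventual_bounds_nonempty[OF assms(1)]] assms(2)
    unfolding asymptotic_radius_def by blast
  have "\<forall>\<^sub>F n in sequentially. dist (u n) y < e"
    using y by (rule eventually_mono) (use e' in simp)
  then show ?thesis ..
qed

lemma asymptotic_radius_nonneg:
  assumes "bounded (range u)"
  shows "0 \<le> asymptotic_radius u"
  unfolding asymptotic_radius_def
  by (rule cInf_greatest[OF eventual_bounds_nonempty[OF assms]])
    (auto dest: eventually_dist_less_pos)

lemma bounded_range_comp:
  assumes "bounded (range u)"
  shows "bounded (range (u \<circ> s))"
  using assms by (rule bounded_subset) auto

lemma asymptotic_radius_subseq:
  fixes u :: "nat \<Rightarrow> 'a::metric_space"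
  assumes "bounded (range u)" and "strict_mono s"
  shows "asymptotic_radius (u \<circ> s) \<le> asymptotic_radius u"
proof (rule dense_ge)
  fix e assume "asymptotic_radius u < e"
  then obtain y where "\<forall>\<^sub>F n in sequentially. dist (u n) y < e"
    using asymptotic_radius_less[OF assms(1)] by blast
  then have "\<forall>\<^sub>F n in sequentially. dist ((u \<circ> s) n) y < e"
    unfolding comp_def by (rule eventually_subseq[OF assms(2)])
  then show "asymptotic_radius (u \<circ> s) \<le> e"
    by (rule asymptotic_radius_le)
qed

lemma asymptotic_radius_shift:
  "asymptotic_radius (u \<circ> (+) k) = asymptotic_radius u"
  unfolding asymptotic_radius_def
  by (subst (2) eventually_sequentially_seg[of _ k, symmetric]) (simp add: add.commute)

section \<open>Existence and uniqueness of asymptotic centres in SR spaces\<close>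

text \<open>Two approximate centres at distance at least \<open>D\<close> would eventually trap the
  sequence in an intersection of balls of Chebyshev radius at most \<open>r - \<delta>\<close>,
  contradicting the asymptotic radius \<open>r\<close>. Choosing \<open>\<delta>\<close> before the
  points is what the Cauchy argument requires.\<close>

lemma SR_space_approximate_centers_close:
  assumes "SR_space TYPE('a::metric_space)" and "0 \<le> r" and "0 < D"
  obtains \<delta> where "0 < \<delta>"
    and "\<And>(u :: nat \<Rightarrow> 'a) y z. asymptotic_radius u = r \<Longrightarrow>
      \<forall>\<^sub>F n in sequentially. dist (u n) y < r + \<delta> \<Longrightarrow>
      \<forall>\<^sub>F n in sequentially. dist (u n) z < r + \<delta> \<Longrightarrow> dist y z < D"
\<comment> \<open>Rotundity speaks only of positive radii. For radius 0, the triangle inequality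
  through one common term \<open>u n\<close> does the job.\<close>
proof (cases "r = 0")
  case True
  show ?thesis
  proof (rule that[of "D / 2"])
    fix u :: "nat \<Rightarrow> 'a" and y z
    assume "\<forall>\<^sub>F n in sequentially. dist (u n) y < r + D / 2"
      and "\<forall>\<^sub>F n in sequentially. dist (u n) z < r + D / 2"
    then have "\<forall>\<^sub>F n in sequentially. dist (u n) y < D / 2 \<and> dist (u n) z < D / 2"
      by eventually_elim (use True in simp)
    then obtain n where "dist (u n) y < D / 2" "dist (u n) z < D / 2"
      using eventually_happens by force
    then show "dist y z < D"
      by (metis dist_commute dist_triangle_half_r)
  qed (use assms in simp)
next
  case False
  with assms obtain \<delta> where \<delta>: "0 < \<delta>" and rad: "\<And>x y :: 'a. dist x y \<ge> D \<Longrightarrow>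
      chebyshev_radius (ball x (r + \<delta>) \<inter> ball y (r + \<delta>)) \<le> ereal (r - \<delta>)"
    unfolding SR_space_def by (metis order_le_less)
  show ?thesis
  proof (rule that[OF \<delta>], rule ccontr)
    fix u :: "nat \<Rightarrow> 'a" and y z
    assume r: "asymptotic_radius u = r"
      and y: "\<forall>\<^sub>F n in sequentially. dist (u n) y < r + \<delta>"
      and z: "\<forall>\<^sub>F n in sequentially. dist (u n) z < r + \<delta>"
      and "\<not> dist y z < D"
    define X where "X = ball y (r + \<delta>) \<inter> ball z (r + \<delta>)"
    have "chebyshev_radius X \<le> ereal (r - \<delta>)"
      using rad \<open>\<not> dist y z < D\<close> unfolding X_def by simp
    \<comment> \<open>The infimum in the Chebyshev radius may not be attained; giving up
      \<open>\<delta> / 2\<close> yields an actual point \<open>w\<close>.\<close>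
    also have "\<dots> < ereal (r - \<delta> / 2)"
      using \<delta> by simp
    finally obtain w where w: "(SUP v\<in>X. ereal (dist w v)) < ereal (r - \<delta> / 2)"
      unfolding chebyshev_radius_def by (auto simp: INF_less_iff)
    have "dist v w < r - \<delta> / 2" if "v \<in> X" for v
      using order_le_less_trans[OF SUP_upper[OF that] w] by (simp add: dist_commute)
    moreover have "\<forall>\<^sub>F n in sequentially. u n \<in> X"
      using y z by eventually_elim (simp add: X_def dist_commute)
    ultimately have "\<forall>\<^sub>F n in sequentially. dist (u n) w < r - \<delta> / 2"
      by (auto elim: eventually_mono)
    from asymptotic_radius_le[OF this] r \<delta> show False
      by simp
  qed
qed

text \<open>Exact centres are approximate centres for every \<open>\<delta>\<close>, so closeness
  can be applied with \<open>D\<close> equal to their own distance.\<close>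

lemma asymptotic_center_unique:
  fixes u :: "nat \<Rightarrow> 'a::metric_space"
  assumes "SR_space TYPE('a)" and "bounded (range u)"
    and "asymptotic_center u y" and "asymptotic_center u z"
  shows "y = z"
proof (rule ccontr)
  assume "y \<noteq> z"
  then have "0 < dist y z"
    by simp
  from SR_space_approximate_centers_close
      [OF assms(1) asymptotic_radius_nonneg[OF assms(2)] this]
  obtain \<delta> where "0 < \<delta>"
    and *: "\<And>(v :: nat \<Rightarrow> 'a) y' z'. asymptotic_radius v = asymptotic_radius u \<Longrightarrow>
      \<forall>\<^sub>F n in sequentially. dist (v n) y' < asymptotic_radius u + \<delta> \<Longrightarrow>
      \<forall>\<^sub>F n in sequentially. dist (v n) z' < asymptotic_radius u + \<delta> \<Longrightarrow>
      dist y' z' < dist y z"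
    by metis
  have "dist y z < dist y z"
    by (rule *[of u]) (use assms(3,4) \<open>0 < \<delta>\<close> in \<open>auto simp: asymptotic_center_def\<close>)
  then show False
    by simp
qed

text \<open>Points within \<open>inverse (real (Suc k))\<close> of the optimal radius form a Cauchy
  sequence by rotundity, and their limit attains the radius.\<close>

lemma asymptotic_center_exists:
  fixes u :: "nat \<Rightarrow> 'a::complete_space"
  assumes "SR_space TYPE('a)" and "bounded (range u)"
  shows "\<exists>c. asymptotic_center u c"
proof -
  let ?r = "asymptotic_radius u"
  have "\<forall>k. \<exists>y. \<forall>\<^sub>F n in sequentially. dist (u n) y < ?r + inverse (real (Suc k))"
    by (intro allI asymptotic_radius_less[OF assms(2)]) simp
  then obtain y where y: "\<And>k. \<forall>\<^sub>F n in sequentially. dist (u n) (y k) < ?r + inverse (real (Suc k))"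
    by metis
  have y': "\<forall>\<^sub>F n in sequentially. dist (u n) (y k) < ?r + \<epsilon>"
    if "inverse (real (Suc N)) < \<epsilon>" and "N \<le> k" for N k \<epsilon>
  proof -
    have "inverse (real (Suc k)) \<le> inverse (real (Suc N))"
      using that by simp
    with that show ?thesis
      by (intro eventually_mono[OF y[of k]]) linarith
  qed
  have "Cauchy y"
  proof (rule metric_CauchyI)
    fix D :: real assume "0 < D"
    from SR_space_approximate_centers_close
        [OF assms(1) asymptotic_radius_nonneg[OF assms(2)] this]
    obtain \<delta> where "0 < \<delta>"
      and *: "\<And>(v :: nat \<Rightarrow> 'a) y' z'. asymptotic_radius v = ?r \<Longrightarrow>
        \<forall>\<^sub>F n in sequentially. dist (v n) y' < ?r + \<delta> \<Longrightarrow>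
        \<forall>\<^sub>F n in sequentially. dist (v n) z' < ?r + \<delta> \<Longrightarrow> dist y' z' < D"
      by metis
    obtain N where "inverse (real (Suc N)) < \<delta>"
      using reals_Archimedean[OF \<open>0 < \<delta>\<close>] by blast
    then show "\<exists>N. \<forall>m\<ge>N. \<forall>n\<ge>N. dist (y m) (y n) < D"
      by (blast intro: *[OF refl] y')
  qed
  then obtain c where c: "y \<longlonglongrightarrow> c"
    using Cauchy_convergent convergent_def by blast
  have "asymptotic_center u c"
    unfolding asymptotic_center_def
  proof (intro allI impI)
    fix e assume "?r < e"
    \<comment> \<open>Half of the gap pays for the approximate centre \<open>y ?k\<close>, half for
      its distance to \<open>c\<close>.\<close>
    then have e: "0 < (e - ?r) / 2"
      by simp
    obtain N where N: "inverse (real (Suc N)) < (e - ?r) / 2"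
      using reals_Archimedean[OF e] by blast
    obtain K where K: "\<And>k. k \<ge> K \<Longrightarrow> dist (y k) c < (e - ?r) / 2"
      using metric_LIMSEQ_D[OF c e] by blast
    let ?k = "max N K"
    show "\<forall>\<^sub>F n in sequentially. dist (u n) c < e"
      using y'[OF N, of ?k, simplified]
    proof eventually_elim
      case (elim n)
      have "dist (u n) c \<le> dist (u n) (y ?k) + dist (y ?k) c"
        by (rule dist_triangle)
      with elim K[of ?k] show ?case
        by (simp add: field_simps)
    qed
  qed
  then show ?thesis ..
qed

section \<open>Polar convergence and regular subsequences\<close>

text \<open>A polar limit eventually beats every competitor \<open>z\<close>, hence inherits each
  eventual bound that \<open>z\<close> satisfies.\<close>

lemma polarly_converges_imp_asymptotic_center:
  assumes "bounded (range u)" and "polarly_converges u y"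
  shows "asymptotic_center u y"
  unfolding asymptotic_center_def
proof (intro allI impI)
  fix e assume "asymptotic_radius u < e"
  then obtain z where z: "\<forall>\<^sub>F n in sequentially. dist (u n) z < e"
    using asymptotic_radius_less[OF assms(1)] by blast
  show "\<forall>\<^sub>F n in sequentially. dist (u n) y < e"
  proof (cases "z = y")
    case False
    then have "\<forall>\<^sub>F n in sequentially. dist (u n) y < dist (u n) z"
      using assms(2) by (auto simp: polarly_converges_def eventually_sequentially)
    with z show ?thesis
      by eventually_elim simp
  qed (use z in simp)
qed

text \<open>\<open>P n s\<close> allows further refinement of \<open>s\<close> to lower the radius
  by at most \<open>inverse (real (Suc n))\<close>. Tails of the diagonal sequence satisfy every
  \<open>P k\<close>, and tails have the same radius as the whole, so no drop remains.\<close>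

lemma regular_subsequence:
  fixes u :: "nat \<Rightarrow> 'a::metric_space"
  assumes bd: "bounded (range u)"
  obtains s :: "nat \<Rightarrow> nat" where "strict_mono s"
    and "\<And>t :: nat \<Rightarrow> nat. strict_mono t \<Longrightarrow>
      asymptotic_radius (u \<circ> s \<circ> t) = asymptotic_radius (u \<circ> s)"
proof -
  define P where "P n s \<longleftrightarrow> (\<forall>t :: nat \<Rightarrow> nat. strict_mono t \<longrightarrow>
    asymptotic_radius (u \<circ> s) \<le> asymptotic_radius (u \<circ> s \<circ> t) + inverse (real (Suc n)))" for n and s :: "nat \<Rightarrow> nat"
  have bds: "bounded (range (u \<circ> s))" for s :: "nat \<Rightarrow> nat"
    by (rule bounded_range_comp[OF bd])
  interpret subseqs P
  proof
    fix n and s :: "nat \<Rightarrow> nat" assume "strict_mono s"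
    let ?A = "{asymptotic_radius (u \<circ> s \<circ> t) | t. strict_mono t}"
    have ne: "?A \<noteq> {}"
      using strict_mono_id by blast
    have bdd: "bdd_below ?A"
      by (rule bdd_belowI[of _ 0])
        (auto intro!: asymptotic_radius_nonneg bounded_range_comp bds)
    \<comment> \<open>Once the radius is this close to the infimum over all refinements, no later
      refinement can gain more than the error.\<close>
    have "Inf ?A < Inf ?A + inverse (real (Suc n))"
      by simp
    from cInf_lessD[OF ne this] obtain t where t: "strict_mono t"
      and less: "asymptotic_radius (u \<circ> s \<circ> t) < Inf ?A + inverse (real (Suc n))"
      by blast
    have "P n (s \<circ> t)"
      unfolding P_def
    proof (intro allI impI)
      fix t' :: "nat \<Rightarrow> nat" assume "strict_mono t'"
      then have "Inf ?A \<le> asymptotic_radius (u \<circ> s \<circ> (t \<circ> t'))"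
        using t by (intro cInf_lower[OF _ bdd]) (blast intro: strict_mono_o)
      with less show "asymptotic_radius (u \<circ> (s \<circ> t)) \<le>
          asymptotic_radius (u \<circ> (s \<circ> t) \<circ> t') + inverse (real (Suc n))"
        by (simp add: comp_assoc)
    qed
    with t show "\<exists>r'. strict_mono r' \<and> P n (s \<circ> r')"
      by blast
  qed
  have P_subseq: "P n (s \<circ> t)" if "P n s" and "strict_mono t" for n s t
    unfolding P_def
  proof (intro allI impI)
    fix t' :: "nat \<Rightarrow> nat" assume "strict_mono t'"
    with that have "asymptotic_radius (u \<circ> s) \<le>
        asymptotic_radius (u \<circ> s \<circ> (t \<circ> t')) + inverse (real (Suc n))"
      unfolding P_def by (blast intro: strict_mono_o)
    with asymptotic_radius_subseq[OF bds[of s] \<open>strict_mono t\<close>]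
    show "asymptotic_radius (u \<circ> (s \<circ> t)) \<le>
        asymptotic_radius (u \<circ> (s \<circ> t) \<circ> t') + inverse (real (Suc n))"
      by (simp add: comp_assoc)
  qed
  have P_D: "asymptotic_radius (u \<circ> s) \<le>
      asymptotic_radius (u \<circ> s \<circ> t) + inverse (real (Suc n))"
    if "P n s" and "strict_mono t" for n s t
    using that unfolding P_def by blast
  let ?v = "u \<circ> diagseq"
  show ?thesis
  proof (rule that[OF subseq_diagseq])
    fix t :: "nat \<Rightarrow> nat" assume t: "strict_mono t"
    have "asymptotic_radius ?v \<le> asymptotic_radius (?v \<circ> t) + e" if e: "0 < e" for e
    proof -
      obtain k where k: "inverse (real (Suc k)) < e"
        using reals_Archimedean[OF e] by blast
      \<comment> \<open>Only from index \<open>Suc k\<close> on is the diagonal sequence a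
        refinement of the subsequence built to satisfy \<open>P k\<close>.\<close>
      have P: "P k (diagseq \<circ> (+) (Suc k))"
        by (rule diagseq_holds) (rule P_subseq)
      \<comment> \<open>The shift of \<open>?v \<circ> t\<close> is written as a subsequence of the shift of \<open>?v\<close>.\<close>
      define t' where "t' n = t (Suc k + n) - Suc k" for n
      have ge: "Suc k \<le> t (Suc k + n)" for n
        using seq_suble[OF t, of "Suc k + n"] by linarith
      have t': "strict_mono t'"
        unfolding strict_mono_def t'_def
        using ge strict_monoD[OF t] by (intro allI impI diff_less_mono) simp_all
      have "(+) (Suc k) \<circ> t' = t \<circ> (+) (Suc k)"
        using le_add_diff_inverse[OF ge] by (intro ext) (simp only: comp_apply t'_def)
      then have eq: "u \<circ> (diagseq \<circ> (+) (Suc k)) \<circ> t' = ?v \<circ> t \<circ> (+) (Suc k)"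
        by (simp only: comp_assoc)
      have "asymptotic_radius (?v \<circ> (+) (Suc k)) \<le>
          asymptotic_radius (?v \<circ> t \<circ> (+) (Suc k)) + inverse (real (Suc k))"
        using P_D[OF P t'] unfolding eq by (simp only: comp_assoc)
      with k show ?thesis
        unfolding asymptotic_radius_shift by linarith
    qed
    then have "asymptotic_radius ?v \<le> asymptotic_radius (?v \<circ> t)"
      by (rule field_le_epsilon)
    with asymptotic_radius_subseq[OF bds t]
    show "asymptotic_radius (?v \<circ> t) = asymptotic_radius ?v"
      by (rule antisym)
  qed
qed

text \<open>Failure is witnessed by a single competitor \<open>y\<close> at infinitely many indices,
  which are enumerated increasingly.\<close>

lemma not_polarly_convergesE:
  assumes "\<not> polarly_converges u c"
  obtains y and s :: "nat \<Rightarrow> nat" where "y \<noteq> c" and "strict_mono s"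
    and "\<forall>n. dist (u (s n)) y \<le> dist (u (s n)) c"
proof -
  obtain y where "y \<noteq> c" and "\<forall>M. \<exists>n\<ge>M. dist (u n) y \<le> dist (u n) c"
    using assms unfolding polarly_converges_def by (metis not_less)
  then have "infinite {n. dist (u n) y \<le> dist (u n) c}"
    by (simp add: infinite_nat_iff_unbounded_le)
  from infinite_enumerate[OF this] obtain s :: "nat \<Rightarrow> nat"
    where "strict_mono s" and "\<forall>n. dist (u (s n)) y \<le> dist (u (s n)) c"
    by blast
  with \<open>y \<noteq> c\<close> show ?thesis
    using that by blast
qed

text \<open>Along a regular subsequence, a competitor at least as close as the centre infinitely
  often would be a second centre of a further subsequence.\<close>

lemma polarly_convergent_subsequence:
  fixes u :: "nat \<Rightarrow> 'a::complete_space"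
  assumes SR: "SR_space TYPE('a)" and bd: "bounded (range u)"
  obtains s :: "nat \<Rightarrow> nat" and c where "strict_mono s" and "polarly_converges (u \<circ> s) c"
proof -
  obtain s :: "nat \<Rightarrow> nat" where s: "strict_mono s" and
    reg: "\<And>t :: nat \<Rightarrow> nat. strict_mono t \<Longrightarrow>
      asymptotic_radius (u \<circ> s \<circ> t) = asymptotic_radius (u \<circ> s)"
    using regular_subsequence[OF bd] by blast
  have bds: "bounded (range (u \<circ> s))"
    by (rule bounded_range_comp[OF bd])
  obtain c where c: "asymptotic_center (u \<circ> s) c"
    using asymptotic_center_exists[OF SR bds] by blast
  have "polarly_converges (u \<circ> s) c"
  proof (rule ccontr)
    assume "\<not> polarly_converges (u \<circ> s) c"
    then obtain y and t :: "nat \<Rightarrow> nat" where "y \<noteq> c" and t: "strict_mono t"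
      and le: "\<forall>n. dist ((u \<circ> s) (t n)) y \<le> dist ((u \<circ> s) (t n)) c"
      by (rule not_polarly_convergesE)
    \<comment> \<open>Regularity enters here: if the radius dropped along \<open>t\<close>,
      \<open>c\<close> could cease to be a centre.\<close>
    have ct: "asymptotic_center (u \<circ> s \<circ> t) c"
      using c unfolding asymptotic_center_def reg[OF t]
      by (auto simp: comp_def intro: eventually_subseq[OF t])
    have "asymptotic_center (u \<circ> s \<circ> t) y"
      unfolding asymptotic_center_def
    proof (intro allI impI)
      fix e assume "asymptotic_radius (u \<circ> s \<circ> t) < e"
      with ct have "\<forall>\<^sub>F n in sequentially. dist ((u \<circ> s \<circ> t) n) c < e"
        by (simp add: asymptotic_center_def)
      then show "\<forall>\<^sub>F n in sequentially. dist ((u \<circ> s \<circ> t) n) y < e"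
      proof eventually_elim
        case (elim n)
        with spec[OF le, of n] show ?case
          by simp
      qed
    qed
    with asymptotic_center_unique[OF SR bounded_range_comp[OF bds] _ ct] \<open>y \<noteq> c\<close>
    show False
      by blast
  qed
  with s show ?thesis
    by (rule that)
qed

section \<open>Polar limits along the orbit of a nonexpansive map\<close>

text \<open>Nonexpansiveness bounds the distance from the \<open>k n\<close>-th iterate to
  \<open>T y\<close> by that from its predecessor to \<open>y\<close>, which the PAR-condition
  controls; so \<open>T y\<close> is a centre too.\<close>

lemma PAR_polar_limit_fixed:
  fixes T :: "'a::metric_space \<Rightarrow> 'a"
  assumes SR: "SR_space TYPE('a)" and bd: "bounded (range (\<lambda>n. (T ^^ n) x))"
    and T: "nonexpansive T" and PAR: "PAR_condition T x"
    and k: "strict_mono k" and lim: "polarly_converges (\<lambda>n. (T ^^ k n) x) y"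
  shows "T y = y"
proof -
  let ?v = "\<lambda>n. (T ^^ k n) x"
  have bdv: "bounded (range ?v)"
    using bounded_range_comp[OF bd, of k] by (simp add: comp_def)
  have cy: "asymptotic_center ?v y"
    by (rule polarly_converges_imp_asymptotic_center[OF bdv lim])
  have "asymptotic_center ?v (T y)"
    unfolding asymptotic_center_def
  proof (intro allI impI)
    let ?r = "asymptotic_radius ?v"
    fix e assume e: "?r < e"
    define \<epsilon> where "\<epsilon> = (e - ?r) / 2"
    have \<epsilon>: "0 < \<epsilon>" "e = ?r + \<epsilon> + \<epsilon>"
      using e by (simp_all add: \<epsilon>_def field_simps)
    have "\<forall>\<^sub>F n in sequentially. dist ((T ^^ (k n - 1)) x) y < dist (?v n) y + \<epsilon>"
      using PAR k lim \<epsilon>(1) unfolding PAR_condition_def eventually_sequentially by blast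
    moreover have "\<forall>\<^sub>F n in sequentially. dist (?v n) y < ?r + \<epsilon>"
      using cy \<epsilon>(1) by (simp add: asymptotic_center_def)
    ultimately show "\<forall>\<^sub>F n in sequentially. dist (?v n) (T y) < e"
      using eventually_gt_at_top[of 0]
    proof eventually_elim
      case (elim n)
      \<comment> \<open>Since \<open>n\<close> is positive, so is \<open>k n\<close>: the
        subtraction is not truncated and one \<open>T\<close> can be split off.\<close>
      have "n \<le> k n"
        using k by (rule seq_suble)
      with elim have "?v n = T ((T ^^ (k n - 1)) x)"
        by (cases "k n") auto
      then have "dist (?v n) (T y) \<le> dist ((T ^^ (k n - 1)) x) y"
        using T by (simp add: nonexpansive_def)
      with elim \<epsilon> show ?case
        by linarith
    qed
  qed
  from asymptotic_center_unique[OF SR bdv this cy] show ?thesis .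
qed

text \<open>The distances decrease because \<open>T\<close> fixes \<open>y\<close>. A limit along
  the whole orbit lets different subsequences be compared.\<close>

lemma nonexpansive_dist_fixed_convergent:
  assumes "nonexpansive T" and "T y = y"
  shows "convergent (\<lambda>n. dist ((T ^^ n) x) y)"
proof (rule Bseq_monoseq_convergent)
  have dec: "decseq (\<lambda>n. dist ((T ^^ n) x) y)"
    using assms unfolding nonexpansive_def by (intro decseq_SucI) (metis comp_apply funpow.simps(2))
  then show "monoseq (\<lambda>n. dist ((T ^^ n) x) y)"
    by (rule decseq_imp_monoseq)
  show "Bseq (\<lambda>n. dist ((T ^^ n) x) y)"
    using decseqD[OF dec, of 0] by (intro BseqI'[of _ "dist x y"]) simp
qed

lemma polarly_converges_limit_dist_le:
  assumes "polarly_converges (u \<circ> s) y" and "strict_mono s"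
    and "(\<lambda>n. dist (u n) y) \<longlonglongrightarrow> a" and "(\<lambda>n. dist (u n) z) \<longlonglongrightarrow> b"
  shows "a \<le> b"
proof (cases "z = y")
  case True
  with assms(3,4) show ?thesis
    using LIMSEQ_unique by blast
next
  case False
  with assms(1) obtain M where "\<forall>n\<ge>M. dist (u (s n)) y < dist (u (s n)) z"
    unfolding polarly_converges_def comp_def by metis
  then show ?thesis
    using LIMSEQ_le[OF LIMSEQ_subseq_LIMSEQ[OF assms(3,2)] LIMSEQ_subseq_LIMSEQ[OF assms(4,2)]]
    by (auto intro: less_imp_le)
qed

lemma asymptotic_center_same_limit_dist:
  assumes "asymptotic_center u y"
    and "(\<lambda>n. dist (u n) y) \<longlonglongrightarrow> a" and "(\<lambda>n. dist (u n) z) \<longlonglongrightarrow> a"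
  shows "asymptotic_center u z"
  unfolding asymptotic_center_def
proof (intro allI impI)
  fix e assume e: "asymptotic_radius u < e"
  \<comment> \<open>The limit only gives \<open>a \<le> e'\<close>; the intermediate
    \<open>e'\<close> restores the strict bound \<open>a < e\<close>.\<close>
  then obtain e' where e': "asymptotic_radius u < e'" "e' < e"
    using dense by blast
  then have "\<forall>\<^sub>F n in sequentially. dist (u n) y < e'"
    using assms(1) by (simp add: asymptotic_center_def)
  then have "a \<le> e'"
    by (intro tendsto_upperbound[OF assms(2)]) (auto elim: eventually_mono)
  with e' show "\<forall>\<^sub>F n in sequentially. dist (u n) z < e"
    by (intro order_tendstoD(2)[OF assms(3)]) simp
qed

theorem theorem8p4:
  fixes T :: "'a::complete_space \<Rightarrow> 'a" and x :: 'a
  assumes "bounded (UNIV :: 'a set)"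
    and "SR_space TYPE('a)"
    and "nonexpansive T"
    and "PAR_condition T x"
  shows "\<exists>p. T p = p \<and> polarly_converges (\<lambda>n. (T ^^ n) x) p"
proof -
  let ?u = "\<lambda>n. (T ^^ n) x"
  have bd: "bounded (range v)" for v :: "nat \<Rightarrow> 'a"
    using assms(1) by (rule bounded_subset) simp
  have fixed: "T y = y" if "strict_mono s" and "polarly_converges (?u \<circ> s) y" for s y
    using PAR_polar_limit_fixed[OF assms(2) bd assms(3,4)] that by (simp add: comp_def)
  have unique: "y = z" if s: "strict_mono s" "polarly_converges (?u \<circ> s) y"
    and t: "strict_mono t" "polarly_converges (?u \<circ> t) z" for s t y z
  proof -
    obtain a where a: "(\<lambda>n. dist (?u n) y) \<longlonglongrightarrow> a"
      using nonexpansive_dist_fixed_convergent[OF assms(3) fixed[OF s]] convergent_def by blast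
    obtain b where b: "(\<lambda>n. dist (?u n) z) \<longlonglongrightarrow> b"
      using nonexpansive_dist_fixed_convergent[OF assms(3) fixed[OF t]] convergent_def by blast
    \<comment> \<open>Each point is closest along its own subsequence, but the limits
      \<open>a\<close> and \<open>b\<close> belong to the whole orbit, so both inequalities
      hold.\<close>
    have "a = b"
      using polarly_converges_limit_dist_le[OF s(2,1) a b]
        polarly_converges_limit_dist_le[OF t(2,1) b a] by simp
    have cy: "asymptotic_center (?u \<circ> s) y"
      by (rule polarly_converges_imp_asymptotic_center[OF bd s(2)])
    \<comment> \<open>Equal limits make \<open>z\<close> a centre along \<open>s\<close> as well,
      where uniqueness applies.\<close>
    have "asymptotic_center (?u \<circ> s) z"
      using asymptotic_center_same_limit_dist[OF cy, of a]
        LIMSEQ_subseq_LIMSEQ[OF a s(1)] LIMSEQ_subseq_LIMSEQ[OF b s(1)] \<open>a = b\<close>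
      by (simp add: comp_def)
    from asymptotic_center_unique[OF assms(2) bd cy this] show ?thesis .
  qed
  obtain s :: "nat \<Rightarrow> nat" and p where s: "strict_mono s" "polarly_converges (?u \<circ> s) p"
    by (rule polarly_convergent_subsequence[OF assms(2) bd])
  have "polarly_converges ?u p"
  proof (rule ccontr)
    assume "\<not> polarly_converges ?u p"
    then obtain y and t :: "nat \<Rightarrow> nat" where "y \<noteq> p" and t: "strict_mono t"
      and le: "\<forall>n. dist (?u (t n)) y \<le> dist (?u (t n)) p"
      by (rule not_polarly_convergesE)
    \<comment> \<open>The bad subsequence has a polarly convergent refinement. Its limit must again
      be \<open>p\<close>, which then eventually beats \<open>y\<close>, contrary to the choice of
      \<open>t\<close>.\<close>
    obtain t' :: "nat \<Rightarrow> nat" and q where t': "strict_mono t'" "polarly_converges (?u \<circ> t \<circ> t') q"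
      by (rule polarly_convergent_subsequence[OF assms(2) bd])
    then have "q = p"
      using unique[OF _ _ s, of "t \<circ> t'" q] strict_mono_o[OF t t'(1)] by (simp add: comp_assoc)
    with t'(2) \<open>y \<noteq> p\<close> obtain M where "\<forall>n\<ge>M. dist (?u (t (t' n))) p < dist (?u (t (t' n))) y"
      unfolding polarly_converges_def comp_def by blast
    with le show False
      by (meson not_le order_refl)
  qed
  with fixed[OF s] show ?thesis
    by blast
qed

end
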